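(* Let $(X,d)$ be an $m$-space and let $P_1,P_2$ be nonempty subsets of $X$. Then there exists a zone diagram in $X$ with respect to $(P_1,P_2)$, i.e., there exist nonempty sets $R_1,R_2\subseteq X$ such that $R_1=\mathrm{dom}(P_1,R_2)$ and $R_2=\mathrm{dom}(P_2,R_1)$.
   Context: An $m$-space is a pair $(X,d)$ of a nonempty set $X$ and a function $d:X^2\to[-\infty,\infty]$ such that $d(x,x)\le d(x,y)$ for all $x,y\in X$ (no symmetry, positivity or triangle inequality is assumed). For $x\in X$ and a nonempty $A\subseteq X$, $d(x,A)=\inf\{d(x,y):y\in A\}$. For nonempty $P,A\subseteq X$, $\mathrm{dom}(P,A)=\{x\in X: d(x,P)\le d(x,A)\}$. A zone diagram with respect to a pair $(P_1,P_2)$ of nonempty subsets of $X$ is a pair $(R_1,R_2)$ of nonempty subsets of $X$ with $R_1=\mathrm{dom}(P_1,R_2)$ and $R_2=\mathrm{dom}(P_2,R_1)$. *)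

theory Defs
  imports "HOL-Library.Extended_Real"
begin

text \<open>
  The underlying set is an explicit carrier \<open>X\<close>; the values of \<open>d\<close> outside
  \<open>X \<times> X\<close> are irrelevant.
\<close>

definition m_space :: "'a set \<Rightarrow> ('a \<Rightarrow> 'a \<Rightarrow> ereal) \<Rightarrow> bool" where
  "m_space X d \<longleftrightarrow> X \<noteq> {} \<and> (\<forall>x\<in>X. \<forall>y\<in>X. d x x \<le> d x y)"

definition set_dist :: "('a \<Rightarrow> 'a \<Rightarrow> ereal) \<Rightarrow> 'a \<Rightarrow> 'a set \<Rightarrow> ereal" where
  "set_dist d x A = (INF y\<in>A. d x y)"

text \<open>The mathematical \<open>dom(P, A)\<close>; the name avoids a clash with the domain of a map.\<close>

definition dom_region :: "'a set \<Rightarrow> ('a \<Rightarrow> 'a \<Rightarrow> ereal) \<Rightarrow> 'a set \<Rightarrow> 'a set \<Rightarrow> 'a set" where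
  "dom_region X d P A = {x \<in> X. set_dist d x P \<le> set_dist d x A}"

definition zone_diagram ::
  "'a set \<Rightarrow> ('a \<Rightarrow> 'a \<Rightarrow> ereal) \<Rightarrow> 'a set \<times> 'a set \<Rightarrow> 'a set \<times> 'a set \<Rightarrow> bool" where
  "zone_diagram X d = (\<lambda>(P1, P2) (R1, R2).
     R1 \<noteq> {} \<and> R1 \<subseteq> X \<and> R2 \<noteq> {} \<and> R2 \<subseteq> X \<and>
     R1 = dom_region X d P1 R2 \<and> R2 = dom_region X d P2 R1)"

end

theory Submission
  imports Defs
begin

text \<open>
  The operator \<open>A \<mapsto> dom(P, A)\<close> is antitone: enlarging \<open>A\<close> lowers \<open>d(x, A)\<close>. Hence
  \<open>A \<mapsto> dom(P1, dom(P2, A))\<close> is monotone on the complete lattice of sets, and has a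
  fixed point \<open>R1\<close> by the Knaster--Tarski theorem; with \<open>R2 = dom(P2, R1)\<close> both equations
  of a zone diagram hold. The \<open>m\<close>-space axiom enters only for nonemptiness: if \<open>x \<in> P\<close>, then
  \<open>d(x, P) = d(x, x) \<le> d(x, A)\<close>, so that \<open>P \<subseteq> dom(P, A)\<close>.
\<close>

lemma dom_region_subset: "dom_region X d P A \<subseteq> X"
  by (auto simp: dom_region_def)

lemma antimono_dom_region: "antimono (dom_region X d P)"
proof (rule antimonoI)
  fix A B :: "'a set"
  assume "A \<subseteq> B"
  then have "set_dist d x B \<le> set_dist d x A" for x
    unfolding set_dist_def by (rule INF_superset_mono) simp
  then show "dom_region X d P B \<subseteq> dom_region X d P A"
    by (auto simp: dom_region_def intro: order_trans)
qed

lemma sites_subset_dom_region: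
  assumes "m_space X d" and "P \<subseteq> X" and "A \<subseteq> X"
  shows "P \<subseteq> dom_region X d P A"
proof
  fix x
  assume x: "x \<in> P"
  have "set_dist d x P \<le> d x x"
    unfolding set_dist_def using x by (rule INF_lower)
  also have "d x x \<le> set_dist d x A"
    unfolding set_dist_def using assms x
    by (intro INF_greatest) (auto simp: m_space_def)
  finally show "x \<in> dom_region X d P A"
    using x assms(2) by (auto simp: dom_region_def)
qed

theorem theorem5p6:
  fixes X :: "'a set" and d :: "'a \<Rightarrow> 'a \<Rightarrow> ereal" and P1 P2 :: "'a set"
  assumes "m_space X d"
    and "P1 \<noteq> {}" and "P1 \<subseteq> X"
    and "P2 \<noteq> {}" and "P2 \<subseteq> X"
  shows "\<exists>R1 R2. zone_diagram X d (P1, P2) (R1, R2)"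
proof -
  define F where "F A = dom_region X d P1 (dom_region X d P2 A)" for A
  define R1 where "R1 = lfp F"
  define R2 where "R2 = dom_region X d P2 R1"
  have "mono F"
    unfolding F_def by (intro monoI antimonoD[OF antimono_dom_region])
  then have R1: "R1 = dom_region X d P1 R2"
    unfolding R1_def R2_def by (subst lfp_unfold) (simp_all add: F_def)
  have sub: "R1 \<subseteq> X" "R2 \<subseteq> X"
    by (subst R1, rule dom_region_subset) (unfold R2_def, rule dom_region_subset)
  have "P1 \<subseteq> R1"
    by (subst R1) (rule sites_subset_dom_region[OF assms(1,3) sub(2)])
  moreover have "P2 \<subseteq> R2"
    using sites_subset_dom_region[OF assms(1,5) sub(1)] by (simp add: R2_def)
  ultimately have "R1 \<noteq> {}" "R2 \<noteq> {}"
    using assms(2,4) by auto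
  then have "zone_diagram X d (P1, P2) (R1, R2)"
    unfolding zone_diagram_def prod.case using sub R1 R2_def by blast
  then show ?thesis by blast
qed

end
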